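(* Let $H\in(0,\tfrac12)$, $T>0$, and let $B^{(1)},B^{(2)}$ be two independent fractional Brownian motions with Hurst index $H$. For $\varepsilon>0$ set \[ \widetilde G_\varepsilon=\int_0^T B^{(1)}_u\,\frac{B^{(2)}_{u+\varepsilon}-B^{(2)}_u}{\varepsilon}\,\mathrm du . \] Let \[ S=\sqrt{\int_0^\infty\big(|x+1|^{2H}+|x-1|^{2H}-2|x|^{2H}\big)\,\mathrm dx\times\int_0^T\big(B^{(1)}_u\big)^2\,\mathrm du}, \] and let $N\sim\mathscr N(0,1)$ be independent of $(B^{(1)},B^{(2)})$. Then, as $\varepsilon\to0$, \[ \Big(\big(B^{(1)}_t,B^{(2)}_t\big)_{t\in[0,T]},\ \varepsilon^{1/2-H}\,\widetilde G_\varepsilon\Big)\ \xrightarrow{\ \mathrm{Law}\ }\ \Big(\big(B^{(1)}_t,B^{(2)}_t\big)_{t\in[0,T]},\ N\times S\Big). \]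
   Context: A fractional Brownian motion with Hurst index $H\in(0,1)$ is a centered Gaussian process $(B_t)_{t\ge0}$ with covariance $E(B_tB_s)=\tfrac12(t^{2H}+s^{2H}-|t-s|^{2H})$ (taken with continuous paths). Convergence in law is of random elements of $C([0,T];\mathbb R^2)\times\mathbb R$. *)

theory Defs
  imports "HOL-Probability.Probability"
begin

definition centered_normal_rv :: "'a measure \<Rightarrow> ('a \<Rightarrow> real) \<Rightarrow> real \<Rightarrow> bool" where
  "centered_normal_rv M X v \<longleftrightarrow>
     X \<in> borel_measurable M \<and>
     ((v > 0 \<and> distributed M lborel X (normal_density 0 (sqrt v))) \<or>
      (v = 0 \<and> (AE \<omega> in M. X \<omega> = 0)))"

definition fBm :: "'a measure \<Rightarrow> real \<Rightarrow> (real \<Rightarrow> 'a \<Rightarrow> real) \<Rightarrow> bool" where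
  "fBm M H B \<longleftrightarrow>
     0 < H \<and> H < 1 \<and>
     (\<forall>t\<ge>0. B t \<in> borel_measurable M) \<and>
     (\<forall>I c. finite I \<and> I \<subseteq> {0..} \<longrightarrow>
        (\<exists>v. centered_normal_rv M (\<lambda>\<omega>. \<Sum>t\<in>I. c t * B t \<omega>) v)) \<and>
     (\<forall>s\<ge>0. \<forall>t\<ge>0. integral\<^sup>L M (\<lambda>\<omega>. B t \<omega> * B s \<omega>)
          = (t powr (2*H) + s powr (2*H) - \<bar>t - s\<bar> powr (2*H)) / 2) \<and>
     (\<forall>\<omega>\<in>space M. continuous_on {0..} (\<lambda>t. B t \<omega>))"

text \<open>Bounded continuous real functionals on C([0,T];R^2) x R (sup norm on paths).
  A path is represented by a function real => real*real, of which only the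
  restriction to [0,T] matters (continuity forces this).\<close>
definition bcont_CT :: "real \<Rightarrow> ((real \<Rightarrow> real \<times> real) \<Rightarrow> real \<Rightarrow> real) \<Rightarrow> bool" where
  "bcont_CT T f \<longleftrightarrow>
     (\<exists>K. \<forall>w x. continuous_on {0..T} w \<longrightarrow> \<bar>f w x\<bar> \<le> K) \<and>
     (\<forall>w x. continuous_on {0..T} w \<longrightarrow>
        (\<forall>e>0. \<exists>d>0. \<forall>w' x'. continuous_on {0..T} w' \<and>
            (\<forall>t\<in>{0..T}. dist (w' t) (w t) < d) \<and> \<bar>x' - x\<bar> < d \<longrightarrow>
            \<bar>f w' x' - f w x\<bar> < e))"

text \<open>Independence of two random elements with possibly different value types
  (the library's indep_var requires equal types): the generated sigma-algebras
  (preimage families) are independent.\<close>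
definition indep_rv :: "'a measure \<Rightarrow> 'b measure \<Rightarrow> ('a \<Rightarrow> 'b) \<Rightarrow> 'c measure \<Rightarrow> ('a \<Rightarrow> 'c) \<Rightarrow> bool" where
  "indep_rv M Ma X Mb Y \<longleftrightarrow>
     X \<in> measurable M Ma \<and> Y \<in> measurable M Mb \<and>
     prob_space.indep_set M {X -` A \<inter> space M | A. A \<in> sets Ma} {Y -` A \<inter> space M | A. A \<in> sets Mb}"

end

theory Submission
  imports Defs
begin

text \<open>
  For \<open>H < 1/2\<close> the second difference of \<open>\<bar>x\<bar> powr (2*H)\<close> integrates to zero over the half line, so
  \<open>S\<close> vanishes and the limit law is that of \<open>((B1, B2), 0)\<close>. It therefore suffices that the rescaled
  integral tends to zero in \<open>L\<^sup>2\<close>. By independence and Fubini its second moment is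
  \<open>(1 / (2 * \<epsilon>)) * \<integral>\<integral> R u v * \<rho> ((u - v) / \<epsilon>)\<close> over the square \<open>{0..T} \<times> {0..T}\<close>, where \<open>R\<close> is the
  covariance of fractional Brownian motion and \<open>\<rho>\<close> the integrable second difference; substituting
  \<open>v = u - \<epsilon> * x\<close> and using dominated convergence, this tends to \<open>1/2 * (\<integral> R u u) * (\<integral> \<rho>) = 0\<close>.
\<close>

section \<open>The second difference of a power\<close>

text \<open>Away from 0 this is the product rule on each sign branch. At 0 the difference quotient
  is \<open>\<bar>h\<bar> powr p / (p + 1)\<close>, which vanishes in the limit since
  \<open>p > 0\<close>. Having one odd formula on the whole line lets later integrals run across the
  kinks of the integrand.\<close>

lemma DERIV_abs_powr_primitive:
  fixes p x :: real
  assumes "p > 0"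
  shows "((\<lambda>x. x * \<bar>x\<bar> powr p / (p + 1)) has_real_derivative \<bar>x\<bar> powr p) (at x)"
proof -
  consider "x > 0" | "x < 0" | "x = 0" by linarith
  then show ?thesis
  proof cases
    case 1
    have "((\<lambda>x. x * x powr p) has_real_derivative x powr p + x * (p * x powr (p - 1))) (at x)"
      using 1 by (auto intro!: derivative_eq_intros)
    then have "((\<lambda>x. x * x powr p / (p + 1)) has_real_derivative
        (x powr p + x * (p * x powr (p - 1))) / (p + 1)) (at x)"
      by (rule DERIV_cdivide)
    moreover have "(x powr p + x * (p * x powr (p - 1))) / (p + 1) = \<bar>x\<bar> powr p"
      using 1 assms by (simp add: powr_diff divide_eq_eq algebra_simps)
    ultimately have "((\<lambda>x. x * x powr p / (p + 1)) has_real_derivative \<bar>x\<bar> powr p) (at x)"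
      by simp
    then show ?thesis
      by (rule has_field_derivative_transform_within_open[where S="{0<..}"]) (use 1 in auto)
  next
    case 2
    have "((\<lambda>x. x * (-x) powr p) has_real_derivative (-x) powr p - x * (p * (-x) powr (p - 1))) (at x)"
      using 2 by (auto intro!: derivative_eq_intros)
    then have "((\<lambda>x. x * (-x) powr p / (p + 1)) has_real_derivative
        ((-x) powr p - x * (p * (-x) powr (p - 1))) / (p + 1)) (at x)"
      by (rule DERIV_cdivide)
    moreover have "((-x) powr p - x * (p * (-x) powr (p - 1))) / (p + 1) = \<bar>x\<bar> powr p"
      using 2 assms by (simp add: powr_diff divide_eq_eq algebra_simps)
    ultimately have "((\<lambda>x. x * (-x) powr p / (p + 1)) has_real_derivative \<bar>x\<bar> powr p) (at x)"
      by simp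
    then show ?thesis
      by (rule has_field_derivative_transform_within_open[where S="{..<0}"]) (use 2 in auto)
  next
    case 3
    have "((\<lambda>h. \<bar>h\<bar> powr p / (p + 1)) \<longlongrightarrow> 0) (at 0)"
      using assms by (auto intro!: tendsto_eq_intros tendsto_powr'[where b=p])
    then have "((\<lambda>h. (h * \<bar>h\<bar> powr p / (p + 1)) / h) \<longlongrightarrow> 0) (at 0)"
      by (rule Lim_transform_eventually) (auto simp: eventually_at_filter)
    then show ?thesis using 3 assms by (simp add: DERIV_def)
  qed
qed

text \<open>Concavity in quantitative form: by the mean value theorem the increment is a derivative
  at an intermediate point, and \<open>p < 1\<close> makes that derivative decreasing.\<close>

lemma powr_diff_bounds:
  fixes a b p :: real
  assumes "0 < a" "a < b" "0 < p" "p < 1"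
  shows "(b - a) * (p * b powr (p - 1)) \<le> b powr p - a powr p"
    and "b powr p - a powr p \<le> (b - a) * (p * a powr (p - 1))"
proof -
  have "\<exists>z>a. z < b \<and> b powr p - a powr p = (b - a) * (p * z powr (p - 1))"
    using assms by (intro MVT2) (auto intro!: derivative_eq_intros)
  then obtain z where z: "a < z" "z < b" "b powr p - a powr p = (b - a) * (p * z powr (p - 1))"
    by blast
  have "b powr (p - 1) \<le> z powr (p - 1)" "z powr (p - 1) \<le> a powr (p - 1)"
    using z assms by (auto intro!: powr_mono2')
  then show "(b - a) * (p * b powr (p - 1)) \<le> b powr p - a powr p"
    and "b powr p - a powr p \<le> (b - a) * (p * a powr (p - 1))"
    unfolding z(3) using assms by (auto intro!: mult_left_mono)
qed

text \<open>For \<open>p = 2 * H\<close> this is twice the covariance, at lag \<open>x\<close>, of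
  unit-step increments of fractional Brownian motion.\<close>

definition powr_diff2 :: "real \<Rightarrow> real \<Rightarrow> real" where
  "powr_diff2 p x = \<bar>x + 1\<bar> powr p + \<bar>x - 1\<bar> powr p - 2 * \<bar>x\<bar> powr p"

definition powr_diff2_primitive :: "real \<Rightarrow> real \<Rightarrow> real" where
  "powr_diff2_primitive p x =
     (x + 1) * \<bar>x + 1\<bar> powr p / (p + 1) + (x - 1) * \<bar>x - 1\<bar> powr p / (p + 1)
     - 2 * (x * \<bar>x\<bar> powr p / (p + 1))"

lemma DERIV_powr_diff2_primitive:
  assumes "p > 0"
  shows "(powr_diff2_primitive p has_real_derivative powr_diff2 p x) (at x)"
proof -
  note D = DERIV_abs_powr_primitive[OF assms]
  have "((\<lambda>x. (x + 1) * \<bar>x + 1\<bar> powr p / (p + 1)) has_real_derivative \<bar>x + 1\<bar> powr p) (at x)"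
    using D[of "x + 1"] unfolding DERIV_shift .
  moreover have "((\<lambda>x. (x - 1) * \<bar>x - 1\<bar> powr p / (p + 1)) has_real_derivative \<bar>x - 1\<bar> powr p) (at x)"
    using D[of "x + - 1"] unfolding DERIV_shift by simp
  ultimately show ?thesis
    unfolding powr_diff2_primitive_def[abs_def] powr_diff2_def
    by (intro derivative_intros D DERIV_cmult)
qed

text \<open>A second difference is a difference of two first differences. The mean value theorem
  turns these into powers at points of \<open>(x, x + 1)\<close> and \<open>(x - 1, x)\<close>, so
  monotonicity gives the sign. The condition \<open>x > 1\<close> keeps all points positive.\<close>

lemma powr_diff2_primitive_bounds:
  assumes "0 < p" "p < 1" "x > 1"
  shows "0 \<le> powr_diff2_primitive p x"
    and "powr_diff2_primitive p x \<le> 2 * (p * (x - 1) powr (p - 1))"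
proof -
  define P where "P = (\<lambda>x. x * \<bar>x\<bar> powr p / (p + 1))"
  have D: "(P has_real_derivative \<bar>y\<bar> powr p) (at y)" for y
    unfolding P_def by (rule DERIV_abs_powr_primitive) fact
  have "\<exists>z>x. z < x + 1 \<and> P (x + 1) - P x = (x + 1 - x) * \<bar>z\<bar> powr p"
    by (intro MVT2 D) auto
  then obtain z where z: "x < z" "z < x + 1" "P (x + 1) - P x = \<bar>z\<bar> powr p"
    by auto
  have "\<exists>y>x - 1. y < x \<and> P x - P (x - 1) = (x - (x - 1)) * \<bar>y\<bar> powr p"
    by (intro MVT2 D) auto
  then obtain y where y: "x - 1 < y" "y < x" "P x - P (x - 1) = \<bar>y\<bar> powr p"
    by auto
  have "powr_diff2_primitive p x = (P (x + 1) - P x) - (P x - P (x - 1))"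
    by (simp add: powr_diff2_primitive_def P_def)
  then have eq: "powr_diff2_primitive p x = z powr p - y powr p"
    using y z \<open>x > 1\<close> by simp
  show "0 \<le> powr_diff2_primitive p x"
    unfolding eq using y z assms by (auto intro!: powr_mono2)
  \<comment> \<open>The unknown points are pushed out to the ends of an interval of length 2, the
    source of the factor 2 in the bound.\<close>
  have "z powr p - y powr p \<le> (x + 1) powr p - (x - 1) powr p"
    using y z assms by (intro diff_mono powr_mono2) auto
  also have "\<dots> \<le> (x + 1 - (x - 1)) * (p * (x - 1) powr (p - 1))"
    using assms by (intro powr_diff_bounds) auto
  finally show "powr_diff2_primitive p x \<le> 2 * (p * (x - 1) powr (p - 1))"
    unfolding eq by simp
qed

text \<open>The upper bound decays because its exponent \<open>p - 1\<close> is negative; for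
  \<open>p = 2 * H\<close> this is the condition \<open>H < 1/2\<close>.\<close>

lemma powr_diff2_primitive_at_top:
  assumes "0 < p" "p < 1"
  shows "(powr_diff2_primitive p \<longlongrightarrow> 0) at_top"
proof (rule tendsto_sandwich)
  show "\<forall>\<^sub>F x in at_top. 0 \<le> powr_diff2_primitive p x"
    "\<forall>\<^sub>F x in at_top. powr_diff2_primitive p x \<le> 2 * (p * (x - 1) powr (p - 1))"
    using powr_diff2_primitive_bounds[OF assms]
    by (auto intro: eventually_mono[OF eventually_gt_at_top[of 1]])
  have "filterlim (\<lambda>x::real. - 1 + x) at_top at_top"
    by (rule filterlim_tendsto_add_at_top[OF tendsto_const filterlim_ident])
  then have "((\<lambda>x. (x - 1) powr (p - 1)) \<longlongrightarrow> 0) at_top"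
    using assms by (intro tendsto_neg_powr) auto
  from tendsto_mult_right_zero[OF tendsto_mult_right_zero[OF this]]
  show "((\<lambda>x. 2 * (p * (x - 1) powr (p - 1))) \<longlongrightarrow> 0) at_top" .
qed simp

text \<open>By concavity the increments over \<open>[x, x + 1]\<close> and \<open>[x - 1, x]\<close>
  lie on opposite sides of the slope \<open>p * x powr (p - 1)\<close>. The constant sign makes the
  tail accessible to integration of nonnegative functions.\<close>

lemma powr_diff2_nonpos:
  assumes "0 < p" "p < 1" "x > 1"
  shows "powr_diff2 p x \<le> 0"
  using powr_diff_bounds(2)[of x "x + 1" p] powr_diff_bounds(1)[of "x - 1" x p] assms
  by (simp add: powr_diff2_def)

lemma continuous_powr_diff2:
  assumes "p > 0"
  shows "continuous_on A (powr_diff2 p)"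
  unfolding powr_diff2_def[abs_def] using assms
  by (intro continuous_intros continuous_on_powr') auto

lemma borel_measurable_powr_diff2 [measurable]: "powr_diff2 p \<in> borel_measurable borel"
  unfolding powr_diff2_def[abs_def] by measurable

text \<open>The primitive vanishes at 0 by oddness and tends to 0 at infinity, so the integral is 0.
  The half line is cut at 2, a convenient point beyond 1: the compact piece needs only continuity,
  while on the tail the constant sign yields integrability and value together.\<close>

lemma has_bochner_integral_powr_diff2_Ici:
  assumes "0 < p" "p < 1"
  shows "has_bochner_integral lborel (\<lambda>x. indicator {0..} x * powr_diff2 p x) 0"
proof -
  let ?F = "powr_diff2_primitive p"
  note D = DERIV_powr_diff2_primitive[OF \<open>0 < p\<close>]
  have "has_bochner_integral lborel (\<lambda>x. powr_diff2 p x * indicator {0..2} x) (?F 2 - ?F 0)"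
  proof (rule has_bochner_integral_FTC_Icc_real)
    show "isCont (powr_diff2 p) x" for x
      using continuous_powr_diff2[OF \<open>0 < p\<close>, of UNIV] by (simp add: continuous_on_eq_continuous_at)
  qed (simp_all add: D)
  moreover have "has_bochner_integral lborel (\<lambda>x. - powr_diff2 p x * indicator {2..} x) (?F 2)"
  proof (rule has_bochner_integral_nn_integral)
    show "0 \<le> ?F 2"
      using powr_diff2_primitive_bounds(1)[of p 2] assms by simp
    have "((\<lambda>x. - ?F x) \<longlongrightarrow> 0) at_top"
      using tendsto_minus[OF powr_diff2_primitive_at_top[OF assms]] by simp
    then have "(\<integral>\<^sup>+x. ennreal (- powr_diff2 p x) * indicator {2..} x \<partial>lborel) = 0 - (- ?F 2)"
      by (intro nn_integral_FTC_atLeast[where F = "\<lambda>x. - ?F x"])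
         (auto intro!: DERIV_minus D powr_diff2_nonpos assms)
    also have "(\<lambda>x. ennreal (- powr_diff2 p x) * indicator {2..} x)
        = (\<lambda>x. ennreal (- powr_diff2 p x * indicator {2..} x))"
      by (auto simp: fun_eq_iff indicator_def)
    finally show "(\<integral>\<^sup>+x. ennreal (- powr_diff2 p x * indicator {2..} x) \<partial>lborel) = ennreal (?F 2)"
      by simp
  qed (use powr_diff2_nonpos assms in \<open>auto simp: indicator_def\<close>)
  ultimately have "has_bochner_integral lborel (\<lambda>x. powr_diff2 p x * indicator {0..2} x -
      (- powr_diff2 p x * indicator {2..} x)) (?F 2 - ?F 0 - ?F 2)"
    by (rule has_bochner_integral_diff)
  moreover have "?F 0 = 0"
    by (simp add: powr_diff2_primitive_def)
  \<comment> \<open>The two pieces overlap at the single point 2, a null set.\<close>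
  moreover have "AE x in lborel. powr_diff2 p x * indicator {0..2} x -
      (- powr_diff2 p x * indicator {2..} x) = indicator {0..} x * powr_diff2 p x"
    using AE_lborel_singleton[of 2] by eventually_elim (auto simp: indicator_def)
  ultimately show ?thesis
    by (subst has_bochner_integral_cong_AE[symmetric]) auto
qed

text \<open>The function is even, so the half-line integral is doubled. The whole line is needed
  because the scaled lag \<open>(u - v) / \<epsilon>\<close> takes both signs.\<close>

lemma has_bochner_integral_powr_diff2:
  assumes "0 < p" "p < 1"
  shows "has_bochner_integral lborel (powr_diff2 p) 0"
proof -
  have "\<bar>- x + 1\<bar> = \<bar>x - 1\<bar>" "\<bar>- x - 1\<bar> = \<bar>x + 1\<bar>" for x :: real
    by arith+
  then have "powr_diff2 p (- x) = powr_diff2 p x" for x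
    by (simp add: powr_diff2_def)
  then show ?thesis
    using has_bochner_integral_even_function[of "powr_diff2 p" 0]
      has_bochner_integral_powr_diff2_Ici[OF assms] by simp
qed

section \<open>Second moments of integrated processes\<close>

text \<open>Rounding time down to a grid of mesh \<open>1 / Suc n\<close> leaves countably many
  random variables to choose from, which is jointly measurable; path continuity then gives a
  pointwise limit. The truncation \<open>max 0 u\<close> extends the process constantly to negative
  times, so that time can range over the whole line.\<close>

lemma borel_measurable_continuous_process:
  fixes B :: "real \<Rightarrow> 'a \<Rightarrow> real"
  assumes B: "\<And>t. t \<ge> 0 \<Longrightarrow> B t \<in> borel_measurable M"
    and cont: "\<And>\<omega>. \<omega> \<in> space M \<Longrightarrow> continuous_on {0..} (\<lambda>t. B t \<omega>)"
  shows "(\<lambda>(\<omega>, u). B (max 0 u) \<omega>) \<in> borel_measurable (M \<Otimes>\<^sub>M borel)"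
proof -
  define k where "k = (\<lambda>(n::nat) (u::real). nat \<lfloor>max 0 u * real (Suc n)\<rfloor>)"
  define q where "q = (\<lambda>(n::nat) (u::real). real (k n u) / real (Suc n))"
  have meas: "(\<lambda>x. B (q n (snd x)) (fst x)) \<in> borel_measurable (M \<Otimes>\<^sub>M borel)" for n
    unfolding q_def
  proof (rule measurable_compose_countable[where f = "\<lambda>i x. B (real i / real (Suc n)) (fst x)"])
    show "(\<lambda>x. B (real i / real (Suc n)) (fst x)) \<in> borel_measurable (M \<Otimes>\<^sub>M borel)" for i
      by (rule measurable_compose[OF measurable_fst]) (simp add: B)
  qed (simp add: k_def)
  have lim: "(\<lambda>n. q n u) \<longlonglongrightarrow> max 0 u" for u
  proof (rule tendsto_sandwich)
    have *: "max 0 u * real (Suc n) - 1 \<le> real (k n u)" "real (k n u) \<le> max 0 u * real (Suc n)" for n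
      unfolding k_def by linarith (rule of_nat_floor, simp)
    have "max 0 u - 1 / real (Suc n) = (max 0 u * real (Suc n) - 1) / real (Suc n)" for n
      by (simp add: diff_divide_distrib)
    then have "max 0 u - 1 / real (Suc n) \<le> q n u" for n
      using *(1)[of n] by (simp only: q_def divide_right_mono of_nat_0_le_iff)
    moreover have "q n u \<le> max 0 u" for n
      using *(2)[of n] by (simp only: q_def pos_divide_le_eq of_nat_0_less_iff zero_less_Suc)
    ultimately show "\<forall>\<^sub>F n in sequentially. max 0 u - 1 / real (Suc n) \<le> q n u"
      "\<forall>\<^sub>F n in sequentially. q n u \<le> max 0 u" by auto
    show "(\<lambda>n. max 0 u - 1 / real (Suc n)) \<longlonglongrightarrow> max 0 u"
      using tendsto_diff[OF tendsto_const LIMSEQ_inverse_real_of_nat] by (simp add: inverse_eq_divide)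
  qed simp
  have "(\<lambda>x. B (max 0 (snd x)) (fst x)) \<in> borel_measurable (M \<Otimes>\<^sub>M borel)"
  proof (rule borel_measurable_LIMSEQ_real[OF _ meas])
    fix x assume "x \<in> space (M \<Otimes>\<^sub>M (borel :: real measure))"
    then have "fst x \<in> space M" by (auto simp: space_pair_measure)
    from cont[OF this] show "(\<lambda>n. B (q n (snd x)) (fst x)) \<longlonglongrightarrow> B (max 0 (snd x)) (fst x)"
      by (rule continuous_on_tendsto_compose[OF _ lim]) (auto simp: q_def)
  qed
  then show ?thesis
    by (simp add: case_prod_beta')
qed

lemma abs_mult_le_mean_squares: "\<bar>a * b\<bar> \<le> (a\<^sup>2 + b\<^sup>2) / 2" for a b :: real
  using sum_squares_bound[of "\<bar>a\<bar>" "\<bar>b\<bar>"] by (simp add: abs_mult)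

lemma integrable_mult_squares:
  fixes X Y :: "'a \<Rightarrow> real"
  assumes "X \<in> borel_measurable M" "Y \<in> borel_measurable M"
    and "integrable M (\<lambda>\<omega>. (X \<omega>)\<^sup>2)" "integrable M (\<lambda>\<omega>. (Y \<omega>)\<^sup>2)"
  shows "integrable M (\<lambda>\<omega>. X \<omega> * Y \<omega>)"
proof (rule Bochner_Integration.integrable_bound)
  show "integrable M (\<lambda>\<omega>. ((X \<omega>)\<^sup>2 + (Y \<omega>)\<^sup>2) / 2)"
    using assms by simp
  show "AE \<omega> in M. norm (X \<omega> * Y \<omega>) \<le> norm (((X \<omega>)\<^sup>2 + (Y \<omega>)\<^sup>2) / 2)"
    using abs_mult_le_mean_squares by auto
qed (use assms in auto)

text \<open>The square of an integral is a double integral, and Fubini moves the expectation inside.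
  Fubini applies because the mean of squares bounds the expected absolute product by
  \<open>C\<close>, and a constant is integrable over the finite product measure.\<close>

lemma (in prob_space) expectation_square_integral:
  fixes g :: "'a \<Rightarrow> 'b \<Rightarrow> real"
  assumes L: "finite_measure L"
    and g[measurable]: "(\<lambda>(\<omega>, u). g \<omega> u) \<in> borel_measurable (M \<Otimes>\<^sub>M L)"
    and int: "\<And>u. u \<in> space L \<Longrightarrow> integrable M (\<lambda>\<omega>. (g \<omega> u)\<^sup>2)"
    and bound: "\<And>u. u \<in> space L \<Longrightarrow> expectation (\<lambda>\<omega>. (g \<omega> u)\<^sup>2) \<le> C"
  shows "integrable M (\<lambda>\<omega>. (\<integral>u. g \<omega> u \<partial>L)\<^sup>2)"
    and "expectation (\<lambda>\<omega>. (\<integral>u. g \<omega> u \<partial>L)\<^sup>2)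
      = (\<integral>u. \<integral>v. expectation (\<lambda>\<omega>. g \<omega> u * g \<omega> v) \<partial>L \<partial>L)"
proof -
  interpret L: finite_measure L by fact
  interpret LL: pair_sigma_finite L L ..
  interpret LL': finite_measure "L \<Otimes>\<^sub>M L"
    by (rule finite_measure_pair_measure) fact+
  interpret P: pair_sigma_finite "L \<Otimes>\<^sub>M L" M ..
  interpret Q: pair_sigma_finite M "L \<Otimes>\<^sub>M L" ..
  define K where "K = (\<lambda>(p, \<omega>). g \<omega> (fst p) * g \<omega> (snd p))"
  have gm[measurable]: "(\<lambda>\<omega>. g \<omega> u) \<in> borel_measurable M" if "u \<in> space L" for u
    using measurable_compose[OF measurable_Pair2'[OF that, of M] g] by simp
  have K[measurable]: "K \<in> borel_measurable ((L \<Otimes>\<^sub>M L) \<Otimes>\<^sub>M M)"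
    unfolding K_def by measurable
  have Ki: "integrable M (\<lambda>\<omega>. g \<omega> u * g \<omega> v)"
    and Kb: "expectation (\<lambda>\<omega>. \<bar>g \<omega> u * g \<omega> v\<bar>) \<le> C" if "u \<in> space L" "v \<in> space L" for u v
  proof -
    have i: "integrable M (\<lambda>\<omega>. ((g \<omega> u)\<^sup>2 + (g \<omega> v)\<^sup>2) / 2)"
      using int that by simp
    show *: "integrable M (\<lambda>\<omega>. g \<omega> u * g \<omega> v)"
      using that by (intro integrable_mult_squares int) auto
    have "expectation (\<lambda>\<omega>. \<bar>g \<omega> u * g \<omega> v\<bar>) \<le> expectation (\<lambda>\<omega>. ((g \<omega> u)\<^sup>2 + (g \<omega> v)\<^sup>2) / 2)"
      by (intro integral_mono i integrable_abs * abs_mult_le_mean_squares)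
    also have "\<dots> \<le> C"
      using int that bound[of u] bound[of v] by simp
    finally show "expectation (\<lambda>\<omega>. \<bar>g \<omega> u * g \<omega> v\<bar>) \<le> C" .
  qed
  have PK: "integrable ((L \<Otimes>\<^sub>M L) \<Otimes>\<^sub>M M) K"
  proof (rule P.Fubini_integrable[OF K])
    show "integrable (L \<Otimes>\<^sub>M L) (\<lambda>p. \<integral>\<omega>. norm (K (p, \<omega>)) \<partial>M)"
    proof (rule LL'.integrable_const_bound[where B = C])
      show "AE p in L \<Otimes>\<^sub>M L. norm (\<integral>\<omega>. norm (K (p, \<omega>)) \<partial>M) \<le> C"
        by (rule AE_I2) (auto simp: space_pair_measure K_def Kb)
    qed measurable
    show "AE p in L \<Otimes>\<^sub>M L. integrable M (\<lambda>\<omega>. K (p, \<omega>))"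
      by (rule AE_I2) (auto simp: space_pair_measure K_def Ki)
  qed
  have QK: "integrable (M \<Otimes>\<^sub>M (L \<Otimes>\<^sub>M L)) (\<lambda>(\<omega>, p). K (p, \<omega>))"
    using P.integrable_product_swap[OF PK] .
  \<comment> \<open>Integrability of the product kernel is available only for almost every
    \<open>\<omega>\<close>; for those the double integral factors into the square.\<close>
  have "AE \<omega> in M. integrable (L \<Otimes>\<^sub>M L) (\<lambda>p. K (p, \<omega>))"
    using Q.AE_integrable_fst'[OF QK] by simp
  then have eq: "AE \<omega> in M. (\<integral>p. K (p, \<omega>) \<partial>(L \<Otimes>\<^sub>M L)) = (\<integral>u. g \<omega> u \<partial>L)\<^sup>2"
  proof eventually_elim
    case (elim \<omega>)
    from LL.integral_fst'[OF this] show ?case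
      by (simp add: K_def power2_eq_square)
  qed
  have i: "integrable M (\<lambda>\<omega>. \<integral>p. K (p, \<omega>) \<partial>(L \<Otimes>\<^sub>M L))"
    using Q.integrable_fst'[OF QK] by simp
  show "integrable M (\<lambda>\<omega>. (\<integral>u. g \<omega> u \<partial>L)\<^sup>2)"
    by (rule integrable_cong_AE_imp[OF i _ eq]) measurable
  have "expectation (\<lambda>\<omega>. (\<integral>u. g \<omega> u \<partial>L)\<^sup>2) = (\<integral>\<omega>. \<integral>p. K (p, \<omega>) \<partial>(L \<Otimes>\<^sub>M L) \<partial>M)"
    by (rule integral_cong_AE) (use eq in auto)
  also have "\<dots> = (\<integral>p. \<integral>\<omega>. K (p, \<omega>) \<partial>M \<partial>(L \<Otimes>\<^sub>M L))"
    using P.Fubini_integral[of "\<lambda>p \<omega>. K (p, \<omega>)"] PK by simp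
  also have "\<dots> = (\<integral>u. \<integral>v. expectation (\<lambda>\<omega>. g \<omega> u * g \<omega> v) \<partial>L \<partial>L)"
    using LL.integral_fst'[OF P.integrable_fst'[OF PK]] by (simp add: K_def)
  finally show "expectation (\<lambda>\<omega>. (\<integral>u. g \<omega> u \<partial>L)\<^sup>2)
      = (\<integral>u. \<integral>v. expectation (\<lambda>\<omega>. g \<omega> u * g \<omega> v) \<partial>L \<partial>L)" .
qed

text \<open>After division by \<open>\<epsilon>\<close> the kernel concentrates on the diagonal with
  total mass 0. Interior points suffice: at an endpoint the kernel is cut on one side, but the
  endpoints form a null set.\<close>

lemma tendsto_scaled_kernel_integral:
  fixes r :: "real \<Rightarrow> real" and R :: "real \<Rightarrow> real \<Rightarrow> real"
  defines "L T \<equiv> restrict_space lborel {0..T}"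
  assumes r: "has_bochner_integral lborel r 0"
    and R[measurable]: "(\<lambda>(u, v). R u v) \<in> borel_measurable borel"
    and bound: "\<And>u v. u \<in> {0..T} \<Longrightarrow> v \<in> {0..T} \<Longrightarrow> \<bar>R u v\<bar> \<le> C"
    and cont: "\<And>u. u \<in> {0<..<T} \<Longrightarrow> isCont (R u) u"
  shows "((\<lambda>\<epsilon>. (\<integral>u. \<integral>v. R u v * r ((u - v) / \<epsilon>) \<partial>L T \<partial>L T) / \<epsilon>) \<longlongrightarrow> 0) (at_right 0)"
\<comment> \<open>Dominated convergence is applied along sequences; the 1 merely marks a right
  neighbourhood of 0.\<close>
proof (rule tendsto_at_right_sequentially[of 0 1])
  fix S :: "nat \<Rightarrow> real"
  assume S: "\<And>n. 0 < S n" "S \<longlonglongrightarrow> 0"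
  have ri: "integrable lborel r" and r0: "integral\<^sup>L lborel r = 0"
    using r by (auto simp: has_bochner_integral_iff)
  then have [measurable]: "r \<in> borel_measurable borel"
    by auto
  have [measurable]: "(\<lambda>x. R (f x) (g x)) \<in> borel_measurable N"
    if [measurable]: "f \<in> borel_measurable N" "g \<in> borel_measurable N" for f g and N :: "'c measure"
    using measurable_compose[OF borel_measurable_Pair[OF that] R] by simp
  \<comment> \<open>The inner integral after \<open>v = u - S n * x\<close>, with the Jacobian
    \<open>S n\<close> taken out. The indicator carries the restriction of \<open>v\<close> to the
    interval.\<close>
  define h where "h = (\<lambda>n u. \<integral>x. indicator {0..T} (u - S n * x) * R u (u - S n * x) * r x \<partial>lborel)"
  have h_eq: "(\<integral>v. R u v * r ((u - v) / S n) \<partial>L T) = S n * h n u" for n u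
  proof -
    have "(\<integral>v. R u v * r ((u - v) / S n) \<partial>L T)
        = (\<integral>v. indicator {0..T} v * (R u v * r ((u - v) / S n)) \<partial>lborel)"
      unfolding L_def by (subst integral_restrict_space) auto
    also have "\<dots> = S n * h n u"
      using S(1)[of n] unfolding h_def
      by (subst lborel_integral_real_affine[where c = "- S n" and t = u]) (simp_all add: mult.assoc)
    finally show ?thesis .
  qed
  have [measurable]: "h n \<in> borel_measurable borel" for n
    unfolding h_def by measurable
  have dom: "\<bar>indicator {0..T} (u - S n * x) * R u (u - S n * x) * r x\<bar> \<le> \<bar>C\<bar> * \<bar>r x\<bar>"
    if "u \<in> {0..T}" for u n x
    using bound[OF that, of "u - S n * x"] by (auto simp: indicator_def abs_mult intro!: mult_right_mono)
  have hb: "\<bar>h n u\<bar> \<le> \<bar>C\<bar> * (\<integral>x. \<bar>r x\<bar> \<partial>lborel)" if "u \<in> {0..T}" for n u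
  proof -
    have "integrable lborel (\<lambda>x. indicator {0..T} (u - S n * x) * R u (u - S n * x) * r x)"
      by (rule Bochner_Integration.integrable_bound[OF integrable_mult_right[OF integrable_abs[OF ri], of "\<bar>C\<bar>"]])
         (use dom[OF that] in auto)
    then have "\<bar>h n u\<bar> \<le> (\<integral>x. \<bar>C\<bar> * \<bar>r x\<bar> \<partial>lborel)"
      unfolding h_def
      by (intro integral_abs_bound[THEN order_trans] integral_mono integrable_abs integrable_mult_right ri dom that)
    then show ?thesis by simp
  qed
  have lim: "(\<lambda>n. h n u) \<longlonglongrightarrow> 0" if u: "u \<in> {0<..<T}" for u
  proof -
    have "(\<lambda>n. h n u) \<longlonglongrightarrow> (\<integral>x. R u u * r x \<partial>lborel)"
      unfolding h_def
    proof (rule integral_dominated_convergence[where w = "\<lambda>x. \<bar>C\<bar> * \<bar>r x\<bar>"])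
      show "AE x in lborel. (\<lambda>n. indicator {0..T} (u - S n * x) * R u (u - S n * x) * r x) \<longlonglongrightarrow> R u u * r x"
      proof (rule AE_I2)
        fix x
        have *: "(\<lambda>n. u - S n * x) \<longlonglongrightarrow> u"
          using tendsto_diff[OF tendsto_const tendsto_mult_left_zero[OF S(2)]] by simp
        \<comment> \<open>For fixed \<open>x\<close> and interior \<open>u\<close> the shifted point
          is eventually interior too, so the indicator is eventually 1.\<close>
        have "\<forall>\<^sub>F n in sequentially. u - S n * x \<in> {0<..<T}"
          using topological_tendstoD[OF * open_greaterThanLessThan u] .
        then have ev: "\<forall>\<^sub>F n in sequentially. R u (u - S n * x) * r x
            = indicator {0..T} (u - S n * x) * R u (u - S n * x) * r x"
          by eventually_elim auto
        show "(\<lambda>n. indicator {0..T} (u - S n * x) * R u (u - S n * x) * r x) \<longlonglongrightarrow> R u u * r x"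
          by (rule Lim_transform_eventually[OF tendsto_mult[OF isCont_tendsto_compose[OF cont[OF u] *] tendsto_const] ev])
      qed
    qed (use dom u ri in auto)
    then show ?thesis using r0 by simp
  qed
  have "(\<lambda>n. \<integral>u. indicator {0..T} u * h n u \<partial>lborel) \<longlonglongrightarrow> (\<integral>u. 0 \<partial>(lborel :: real measure))"
  proof (rule integral_dominated_convergence[where w = "\<lambda>u. indicator {0..T} u * (\<bar>C\<bar> * (\<integral>x. \<bar>r x\<bar> \<partial>lborel))"])
    show "AE u in lborel. (\<lambda>n. indicator {0..T} u * h n u) \<longlonglongrightarrow> 0"
      using AE_lborel_singleton[of 0] AE_lborel_singleton[of T]
    proof eventually_elim
      case (elim u)
      then show ?case
        using lim[of u] by (cases "u \<in> {0<..<T}") (auto simp: indicator_def)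
    qed
    show "AE u in lborel. norm (indicator {0..T} u * h n u)
        \<le> indicator {0..T} u * (\<bar>C\<bar> * (\<integral>x. \<bar>r x\<bar> \<partial>lborel))" for n
      using hb by (auto simp: indicator_def)
    show "integrable lborel (\<lambda>u. indicator {0..T} u * (\<bar>C\<bar> * (\<integral>x. \<bar>r x\<bar> \<partial>lborel)))"
      by (intro integrable_mult_left) (auto simp: emeasure_lborel_Icc_eq)
  qed auto
  moreover have "(\<integral>u. \<integral>v. R u v * r ((u - v) / S n) \<partial>L T \<partial>L T) / S n
      = (\<integral>u. indicator {0..T} u * h n u \<partial>lborel)" for n
  proof -
    have "(\<integral>u. \<integral>v. R u v * r ((u - v) / S n) \<partial>L T \<partial>L T) = S n * (\<integral>u. h n u \<partial>L T)"
      unfolding h_eq by simp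
    also have "(\<integral>u. h n u \<partial>L T) = (\<integral>u. indicator {0..T} u * h n u \<partial>lborel)"
      unfolding L_def by (subst integral_restrict_space) auto
    finally show ?thesis using S(1)[of n] by simp
  qed
  ultimately show "(\<lambda>n. (\<integral>u. \<integral>v. R u v * r ((u - v) / S n) \<partial>L T \<partial>L T) / S n) \<longlonglongrightarrow> 0"
    by simp
qed simp

section \<open>Continuous functionals of paths\<close>

text \<open>The coefficients are free rather than samples of a given path, so that the path can be
  studied as a continuous function of them.\<close>

definition bernstein_path :: "real \<Rightarrow> nat \<Rightarrow> (nat \<Rightarrow> real \<times> real) \<Rightarrow> real \<Rightarrow> real \<times> real" where
  "bernstein_path T n c t = (\<Sum>k\<le>n. Bernstein n k (t / T) *\<^sub>R c k)"

lemma continuous_on_bernstein_path: "continuous_on A (bernstein_path T n c)"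
  unfolding bernstein_path_def[abs_def] Bernstein_def divide_inverse by (intro continuous_intros)

text \<open>The Bernstein weights on \<open>[0, T]\<close> form a convex combination, and a ball is
  convex; this even preserves the strict inequality.\<close>

lemma dist_bernstein_path_less:
  assumes "T > 0" "t \<in> {0..T}" "\<And>k. k \<le> n \<Longrightarrow> dist (c' k) (c k) < d"
  shows "dist (bernstein_path T n c' t) (bernstein_path T n c t) < d"
proof -
  have "(\<Sum>k\<le>n. Bernstein n k (t / T) *\<^sub>R (c' k - c k)) \<in> ball 0 d"
    by (rule convex_sum)
       (use assms in \<open>auto simp: dist_norm norm_minus_commute intro!: Bernstein_nonneg\<close>)
  then show ?thesis
    by (simp add: bernstein_path_def dist_norm scaleR_diff_right sum_subtractf norm_minus_commute)
qed

text \<open>Bernstein's theorem is applied to each coordinate on \<open>[0, 1]\<close> with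
  tolerance \<open>d / 2\<close>. The clamp \<open>min 1\<close> changes no node with
  \<open>k \<le> n\<close> and keeps the others inside the interval.\<close>

lemma bernstein_path_uniform_limit:
  fixes w :: "real \<Rightarrow> real \<times> real"
  assumes "T > 0" "continuous_on {0..T} w" "d > 0"
  shows "\<forall>\<^sub>F n in sequentially. \<forall>t\<in>{0..T}. dist (bernstein_path T n (\<lambda>k. w (min 1 (k / n) * T)) t) (w t) < d"
proof -
  have *: "\<exists>N. \<forall>n x. N \<le> n \<and> x \<in> {0..1} \<longrightarrow>
      \<bar>\<pi> (w (x * T)) - (\<Sum>k\<le>n. \<pi> (w (k / n * T)) * Bernstein n k x)\<bar> < d / 2"
    if "continuous_on UNIV \<pi>" for \<pi> :: "real \<times> real \<Rightarrow> real"
  proof (rule Bernstein_Weierstrass)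
    have "(\<lambda>x. x * T) ` {0..1} \<subseteq> {0..T}"
      using \<open>T > 0\<close> by (auto intro: mult_le_one mult_left_le_one_le)
    then have "continuous_on {0..1} (\<lambda>x. w (x * T))"
      by (intro continuous_on_compose2[OF assms(2)] continuous_intros) auto
    then show "continuous_on {0..1} (\<lambda>x. \<pi> (w (x * T)))"
      by (rule continuous_on_compose2[OF that]) auto
  qed (use assms in simp)
  obtain N1 where N1: "\<And>n x. N1 \<le> n \<Longrightarrow> x \<in> {0..1} \<Longrightarrow>
      \<bar>fst (w (x * T)) - (\<Sum>k\<le>n. fst (w (k / n * T)) * Bernstein n k x)\<bar> < d / 2"
    using *[of fst] by (auto simp: continuous_on_fst)
  obtain N2 where N2: "\<And>n x. N2 \<le> n \<Longrightarrow> x \<in> {0..1} \<Longrightarrow>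
      \<bar>snd (w (x * T)) - (\<Sum>k\<le>n. snd (w (k / n * T)) * Bernstein n k x)\<bar> < d / 2"
    using *[of snd] by (auto simp: continuous_on_snd)
  show ?thesis
    unfolding eventually_sequentially
  proof (intro exI allI impI ballI)
    fix n t assume n: "max N1 N2 \<le> n" and t: "t \<in> {0..T}"
    let ?c = "\<lambda>k. w (min 1 (real k / real n) * T)"
    \<comment> \<open>For \<open>n = 0\<close> the only node is \<open>0 / 0\<close>, which is 0 by
      convention.\<close>
    have m: "min 1 (real k / real n) = real k / real n" if "k \<le> n" for k
      using that by (cases "n = 0") auto
    have t': "t / T \<in> {0..1}" "t / T * T = t"
      using t \<open>T > 0\<close> by auto
    have "\<bar>fst (w t) - fst (bernstein_path T n ?c t)\<bar> < d / 2"
      using N1[of n "t / T"] n t' by (simp add: bernstein_path_def fst_sum m mult.commute)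
    moreover have "\<bar>snd (w t) - snd (bernstein_path T n ?c t)\<bar> < d / 2"
      using N2[of n "t / T"] n t' by (simp add: bernstein_path_def snd_sum m mult.commute)
    moreover have "dist (bernstein_path T n ?c t) (w t)
        \<le> \<bar>fst (w t) - fst (bernstein_path T n ?c t)\<bar> + \<bar>snd (w t) - snd (bernstein_path T n ?c t)\<bar>"
      unfolding dist_prod_def dist_real_def
      by (rule order_trans[OF sqrt_sum_squares_le_sum_abs]) (simp add: abs_minus_commute)
    ultimately show "dist (bernstein_path T n ?c t) (w t) < d" by linarith
  qed
qed

text \<open>A filter form of the continuity clause of \<open>bcont_CT\<close>, used both along
  sequences and for continuity in the Bernstein coefficients.\<close>

lemma bcont_CT_tendsto:
  assumes f: "bcont_CT T f" and w: "continuous_on {0..T} w"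
    and w': "\<And>i. continuous_on {0..T} (w' i)"
    and lim: "\<And>d. d > 0 \<Longrightarrow> \<forall>\<^sub>F i in F. \<forall>t\<in>{0..T}. dist (w' i t) (w t) < d"
    and x: "(x' \<longlongrightarrow> x) F"
  shows "((\<lambda>i. f (w' i) (x' i)) \<longlongrightarrow> f w x) F"
proof (rule tendstoI)
  fix e :: real assume "e > 0"
  from conjunct2[OF f[unfolded bcont_CT_def], rule_format, OF w this, of x]
  obtain d where "d > 0" and d: "\<And>w' x'. continuous_on {0..T} w' \<Longrightarrow>
      (\<forall>t\<in>{0..T}. dist (w' t) (w t) < d) \<Longrightarrow> \<bar>x' - x\<bar> < d \<Longrightarrow> \<bar>f w' x' - f w x\<bar> < e"
    by blast
  from lim[OF \<open>d > 0\<close>] tendstoD[OF x \<open>d > 0\<close>]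
  show "\<forall>\<^sub>F i in F. dist (f (w' i) (x' i)) (f w x) < e"
  proof eventually_elim
    case (elim i)
    then show ?case
      using d[OF w', of i "x' i"] by (simp add: dist_real_def)
  qed
qed

text \<open>
  Bernstein polynomials exhibit a functional of a continuous path as a limit of continuous functions of
  finitely many values of the path, so no Borel structure on the path space is needed.
\<close>

lemma borel_measurable_bcont_CT:
  fixes W :: "real \<Rightarrow> 'a \<Rightarrow> real \<times> real"
  assumes f: "bcont_CT T f" and "T > 0"
    and W: "\<And>t. t \<in> {0..T} \<Longrightarrow> W t \<in> borel_measurable M"
    and cont: "\<And>\<omega>. \<omega> \<in> space M \<Longrightarrow> continuous_on {0..T} (\<lambda>t. W t \<omega>)"
    and Y: "Y \<in> borel_measurable M"
  shows "(\<lambda>\<omega>. f (\<lambda>t. W t \<omega>) (Y \<omega>)) \<in> borel_measurable M"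
proof (rule borel_measurable_LIMSEQ_real)
  \<comment> \<open>The clamp puts every sampling time in \<open>{0..T}\<close>, so all coordinates,
    including those with \<open>k > n\<close>, are measurable.\<close>
  define c where "c = (\<lambda>(n::nat) \<omega> (k::nat). W (min 1 (k / n) * T) \<omega>)"
  have "continuous_on UNIV (\<lambda>z :: (nat \<Rightarrow> real \<times> real) \<times> real. f (bernstein_path T n (fst z)) (snd z))" for n
    unfolding continuous_on_def
  proof (intro ballI bcont_CT_tendsto[OF f] continuous_on_bernstein_path tendsto_snd tendsto_ident_at)
    fix z :: "(nat \<Rightarrow> real \<times> real) \<times> real" and d :: real assume "d > 0"
    have "((\<lambda>z'. fst z' k) \<longlongrightarrow> fst z k) (at z)" for k
    proof -
      have "continuous_on UNIV (\<lambda>z' :: (nat \<Rightarrow> real \<times> real) \<times> real. fst z' k)"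
        by (rule continuous_on_compose2[OF continuous_on_product_coordinates]) (auto intro: continuous_intros)
      then show ?thesis unfolding continuous_on_def by blast
    qed
    \<comment> \<open>Only finitely many coordinates enter the path, so closeness in the product
      topology is enough.\<close>
    then have "\<forall>\<^sub>F z' in at z. \<forall>k\<in>{..n}. dist (fst z' k) (fst z k) < d"
      using \<open>d > 0\<close> by (intro eventually_ball_finite) (auto dest: tendstoD)
    then show "\<forall>\<^sub>F z' in at z. \<forall>t\<in>{0..T}. dist (bernstein_path T n (fst z') t) (bernstein_path T n (fst z) t) < d"
      by eventually_elim (use \<open>T > 0\<close> in \<open>auto intro: dist_bernstein_path_less\<close>)
  qed
  then have meas: "(\<lambda>z. f (bernstein_path T n (fst z)) (snd z)) \<in> borel_measurable borel" for n
    by (rule borel_measurable_continuous_onI)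
  have "c n \<in> borel_measurable M" for n
    unfolding c_def using \<open>T > 0\<close>
    by (intro measurable_coordinatewise_then_product W) (auto intro!: mult_left_le_one_le)
  then have "(\<lambda>\<omega>. (c n \<omega>, Y \<omega>)) \<in> borel_measurable M" for n
    using Y by (intro borel_measurable_Pair)
  from measurable_compose[OF this meas]
  show "(\<lambda>\<omega>. f (bernstein_path T n (c n \<omega>)) (Y \<omega>)) \<in> borel_measurable M" for n
    by simp
  show "(\<lambda>n. f (bernstein_path T n (c n \<omega>)) (Y \<omega>)) \<longlonglongrightarrow> f (\<lambda>t. W t \<omega>) (Y \<omega>)"
    if "\<omega> \<in> space M" for \<omega>
    unfolding c_def
    by (intro bcont_CT_tendsto[OF f cont[OF that]] continuous_on_bernstein_path
          bernstein_path_uniform_limit[OF \<open>T > 0\<close> cont[OF that]] tendsto_const)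
qed

text \<open>A Slutsky argument with the path component fixed. Failure would give a subsequence of
  expectations staying away from the limit; mean-square convergence supplies an almost surely
  convergent further subsequence, on which bounded convergence contradicts this.\<close>

lemma (in prob_space) bcont_CT_tendsto_expectation:
  fixes W :: "real \<Rightarrow> 'a \<Rightarrow> real \<times> real" and X :: "real \<Rightarrow> 'a \<Rightarrow> real"
  assumes f: "bcont_CT T f" and "T > 0"
    and W: "\<And>t. t \<in> {0..T} \<Longrightarrow> W t \<in> borel_measurable M"
    and cont: "\<And>\<omega>. \<omega> \<in> space M \<Longrightarrow> continuous_on {0..T} (\<lambda>t. W t \<omega>)"
    and X: "\<And>\<epsilon>. \<epsilon> > 0 \<Longrightarrow> X \<epsilon> \<in> borel_measurable M"
    and X2: "\<And>\<epsilon>. \<epsilon> > 0 \<Longrightarrow> integrable M (\<lambda>\<omega>. (X \<epsilon> \<omega>)\<^sup>2)"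
    and lim: "((\<lambda>\<epsilon>. expectation (\<lambda>\<omega>. (X \<epsilon> \<omega>)\<^sup>2)) \<longlongrightarrow> 0) (at_right 0)"
  shows "((\<lambda>\<epsilon>. expectation (\<lambda>\<omega>. f (\<lambda>t. W t \<omega>) (X \<epsilon> \<omega>))) \<longlongrightarrow> expectation (\<lambda>\<omega>. f (\<lambda>t. W t \<omega>) 0)) (at_right 0)"
proof (rule tendsto_at_right_sequentially[of 0 1])
  fix S :: "nat \<Rightarrow> real"
  assume S: "\<And>n. 0 < S n" "S \<longlonglongrightarrow> 0"
  define a where "a = (\<lambda>n. expectation (\<lambda>\<omega>. f (\<lambda>t. W t \<omega>) (X (S n) \<omega>)))"
  define l where "l = expectation (\<lambda>\<omega>. f (\<lambda>t. W t \<omega>) 0)"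
  obtain K where K: "\<And>w x. continuous_on {0..T} w \<Longrightarrow> \<bar>f w x\<bar> \<le> K"
    using conjunct1[OF f[unfolded bcont_CT_def]] by blast
  have "filterlim S (at_right 0) sequentially"
    using S(1) by (intro tendsto_imp_filterlim_at_right S(2)) simp
  from filterlim_compose[OF lim this]
  have ES: "(\<lambda>n. expectation (\<lambda>\<omega>. (X (S n) \<omega>)\<^sup>2)) \<longlonglongrightarrow> 0" .
  have "a \<longlonglongrightarrow> l"
  proof (rule ccontr)
    assume "\<not> a \<longlonglongrightarrow> l"
    then obtain e where "e > 0" and "\<not> (\<forall>\<^sub>F n in sequentially. dist (a n) l < e)"
      by (auto simp: tendsto_iff)
    from not_eventually_sequentiallyD[OF this(2)]
    obtain s :: "nat \<Rightarrow> nat" where s: "strict_mono s" "\<And>n. dist (a (s n)) l \<ge> e"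
      by (auto simp: not_less)
    have "\<exists>r::nat \<Rightarrow> nat. strict_mono r \<and> (AE \<omega> in M. (\<lambda>n. (X (S (s (r n))) \<omega>)\<^sup>2) \<longlonglongrightarrow> 0)"
      by (rule tendsto_L1_AE_subseq[where u = "\<lambda>n \<omega>. (X (S (s n)) \<omega>)\<^sup>2"])
         (use X2 S LIMSEQ_subseq_LIMSEQ[OF ES s(1)] in \<open>auto simp: comp_def\<close>)
    then obtain r :: "nat \<Rightarrow> nat" where r: "strict_mono r"
      "AE \<omega> in M. (\<lambda>n. (X (S (s (r n))) \<omega>)\<^sup>2) \<longlonglongrightarrow> 0" by blast
    have "(\<lambda>n. a (s (r n))) \<longlonglongrightarrow> l"
      unfolding a_def l_def
    proof (rule integral_dominated_convergence[where w = "\<lambda>_. K"])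
      show "(\<lambda>\<omega>. f (\<lambda>t. W t \<omega>) 0) \<in> borel_measurable M"
        by (rule borel_measurable_bcont_CT[OF f \<open>T > 0\<close> W cont]) auto
      show "(\<lambda>\<omega>. f (\<lambda>t. W t \<omega>) (X (S (s (r n))) \<omega>)) \<in> borel_measurable M" for n
        by (rule borel_measurable_bcont_CT[OF f \<open>T > 0\<close> W cont]) (auto intro: X S)
      show "AE \<omega> in M. norm (f (\<lambda>t. W t \<omega>) (X (S (s (r n))) \<omega>)) \<le> K" for n
        by (rule AE_I2) (auto intro: K cont)
      show "AE \<omega> in M. (\<lambda>n. f (\<lambda>t. W t \<omega>) (X (S (s (r n))) \<omega>)) \<longlonglongrightarrow> f (\<lambda>t. W t \<omega>) 0"
        using r(2) AE_space
      proof eventually_elim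
        case (elim \<omega>)
        have "(\<lambda>n. sqrt ((X (S (s (r n))) \<omega>)\<^sup>2)) \<longlonglongrightarrow> sqrt 0"
          using elim by (intro tendsto_real_sqrt)
        then have "(\<lambda>n. X (S (s (r n))) \<omega>) \<longlonglongrightarrow> 0"
          by (simp add: tendsto_rabs_zero_iff)
        then show ?case
          using cont[OF elim(2)] by (intro bcont_CT_tendsto[OF f]) auto
      qed
    qed simp
    from tendstoD[OF this \<open>e > 0\<close>] have "\<forall>\<^sub>F n in sequentially. False"
      by eventually_elim (use s(2) in \<open>auto simp: not_le[symmetric]\<close>)
    then show False by simp
  qed
  then show "(\<lambda>n. expectation (\<lambda>\<omega>. f (\<lambda>t. W t \<omega>) (X (S n) \<omega>))) \<longlonglongrightarrow> expectation (\<lambda>\<omega>. f (\<lambda>t. W t \<omega>) 0)"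
    by (simp add: a_def l_def)
qed simp

section \<open>Fractional Brownian motion\<close>

text \<open>The covariance identity alone does not give integrability, since a non-integrable
  function has integral 0 by convention. It comes from the Gaussian clause for a one-point index set
  with coefficient 1, the degenerate case being treated apart.\<close>

lemma fBm_integrable_square:
  assumes "fBm M H B" "t \<ge> 0"
  shows "integrable M (\<lambda>\<omega>. (B t \<omega>)\<^sup>2)"
proof -
  have "\<exists>v. centered_normal_rv M (\<lambda>\<omega>. \<Sum>t\<in>I. c t * B t \<omega>) v"
    if "finite I" "I \<subseteq> {0..}" for I c
    using assms(1) that unfolding fBm_def by blast
  from this[of "{t}" "\<lambda>_. 1"] obtain v where v: "centered_normal_rv M (B t) v"
    using \<open>t \<ge> 0\<close> by auto
  then have [measurable]: "B t \<in> borel_measurable M"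
    by (simp add: centered_normal_rv_def)
  from v consider "v > 0" "distributed M lborel (B t) (normal_density 0 (sqrt v))" | "AE \<omega> in M. B t \<omega> = 0"
    by (auto simp: centered_normal_rv_def)
  then show ?thesis
  proof cases
    case 1
    have "integrable lborel (\<lambda>x. normal_density 0 (sqrt v) x * x\<^sup>2)"
      using integrable_normal_moment[of "sqrt v" 0 2] \<open>v > 0\<close> by simp
    then show ?thesis
      using distributed_integrable[OF 1(2), of "\<lambda>x. x\<^sup>2"] by simp
  next
    case 2
    then have "AE \<omega> in M. 0 = (B t \<omega>)\<^sup>2" by auto
    from integrable_cong_AE_imp[OF integrable_zero _ this] show ?thesis by simp
  qed
qed

definition fBm_cov :: "real \<Rightarrow> real \<Rightarrow> real \<Rightarrow> real" where
  "fBm_cov H t s = (t powr (2*H) + s powr (2*H) - \<bar>t - s\<bar> powr (2*H)) / 2"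

lemma fBm_has_bochner_integral:
  assumes "fBm M H B" "t \<ge> 0" "s \<ge> 0"
  shows "has_bochner_integral M (\<lambda>\<omega>. B t \<omega> * B s \<omega>) (fBm_cov H t s)"
  using assms unfolding has_bochner_integral_iff
  by (auto intro!: integrable_mult_squares fBm_integrable_square simp: fBm_def fBm_cov_def)

text \<open>In the bilinear expansion the powers of single times cancel, leaving a second difference
  in \<open>u - v\<close>. Homogeneity of the power then extracts
  \<open>\<epsilon> powr (2*H)\<close>.\<close>

lemma fBm_increments_has_bochner_integral:
  assumes B: "fBm M H B" and "u \<ge> 0" "v \<ge> 0" "\<epsilon> > 0"
  shows "has_bochner_integral M (\<lambda>\<omega>. (B (u + \<epsilon>) \<omega> - B u \<omega>) * (B (v + \<epsilon>) \<omega> - B v \<omega>))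
           (\<epsilon> powr (2*H) / 2 * powr_diff2 (2*H) ((u - v) / \<epsilon>))"
proof -
  have "has_bochner_integral M (\<lambda>\<omega>. B (u + \<epsilon>) \<omega> * B (v + \<epsilon>) \<omega> - B (u + \<epsilon>) \<omega> * B v \<omega>
      - B u \<omega> * B (v + \<epsilon>) \<omega> + B u \<omega> * B v \<omega>)
      (fBm_cov H (u + \<epsilon>) (v + \<epsilon>) - fBm_cov H (u + \<epsilon>) v - fBm_cov H u (v + \<epsilon>) + fBm_cov H u v)"
    using assms by (intro has_bochner_integral_add has_bochner_integral_diff fBm_has_bochner_integral[OF B]) auto
  also have "(\<lambda>\<omega>. B (u + \<epsilon>) \<omega> * B (v + \<epsilon>) \<omega> - B (u + \<epsilon>) \<omega> * B v \<omega>
      - B u \<omega> * B (v + \<epsilon>) \<omega> + B u \<omega> * B v \<omega>)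
      = (\<lambda>\<omega>. (B (u + \<epsilon>) \<omega> - B u \<omega>) * (B (v + \<epsilon>) \<omega> - B v \<omega>))"
    by (simp add: fun_eq_iff algebra_simps)
  also have "fBm_cov H (u + \<epsilon>) (v + \<epsilon>) - fBm_cov H (u + \<epsilon>) v - fBm_cov H u (v + \<epsilon>) + fBm_cov H u v
      = (\<bar>(u - v) + \<epsilon>\<bar> powr (2*H) + \<bar>(u - v) - \<epsilon>\<bar> powr (2*H) - 2 * \<bar>u - v\<bar> powr (2*H)) / 2"
    by (simp add: fBm_cov_def field_simps)
  also have "\<dots> = \<epsilon> powr (2*H) / 2 * powr_diff2 (2*H) ((u - v) / \<epsilon>)"
  proof -
    have *: "\<bar>\<epsilon> * x\<bar> powr (2*H) = \<epsilon> powr (2*H) * \<bar>x\<bar> powr (2*H)" for x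
      using \<open>\<epsilon> > 0\<close> by (simp add: abs_mult powr_mult)
    have "(u - v) + \<epsilon> = \<epsilon> * ((u - v) / \<epsilon> + 1)" "(u - v) - \<epsilon> = \<epsilon> * ((u - v) / \<epsilon> - 1)"
      "u - v = \<epsilon> * ((u - v) / \<epsilon>)"
      using \<open>\<epsilon> > 0\<close> by (simp_all add: field_simps)
    then have "\<bar>(u - v) + \<epsilon>\<bar> powr (2*H) = \<epsilon> powr (2*H) * \<bar>(u - v) / \<epsilon> + 1\<bar> powr (2*H)"
      "\<bar>(u - v) - \<epsilon>\<bar> powr (2*H) = \<epsilon> powr (2*H) * \<bar>(u - v) / \<epsilon> - 1\<bar> powr (2*H)"
      "\<bar>u - v\<bar> powr (2*H) = \<epsilon> powr (2*H) * \<bar>(u - v) / \<epsilon>\<bar> powr (2*H)"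
      by (metis *)+
    then show ?thesis
      unfolding powr_diff2_def by (simp only:) (simp only: distrib_left right_diff_distrib, simp)
  qed
  finally show ?thesis .
qed

lemma abs_fBm_cov_le:
  assumes "H > 0" "u \<in> {0..T}" "v \<in> {0..T}"
  shows "\<bar>fBm_cov H u v\<bar> \<le> 2 * T powr (2*H)"
proof -
  have "u powr (2*H) \<le> T powr (2*H)" "v powr (2*H) \<le> T powr (2*H)" "\<bar>u - v\<bar> powr (2*H) \<le> T powr (2*H)"
    using assms by (auto intro!: powr_mono2)
  moreover have "0 \<le> u powr (2*H)" "0 \<le> v powr (2*H)" "0 \<le> \<bar>u - v\<bar> powr (2*H)"
    by auto
  moreover have "\<bar>(a + b - c) / 2\<bar> \<le> 2 * d"
    if "a \<le> d" "b \<le> d" "c \<le> d" "0 \<le> a" "0 \<le> b" "0 \<le> c" for a b c d :: real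
    using that by (simp add: abs_le_iff field_simps)
  ultimately show ?thesis unfolding fBm_cov_def by blast
qed

lemma isCont_fBm_cov:
  assumes "H > 0" "u > 0"
  shows "isCont (fBm_cov H u) u"
proof -
  have "continuous_on {0<..} (fBm_cov H u)"
    unfolding fBm_cov_def[abs_def] using assms
    by (intro continuous_intros continuous_on_powr') auto
  then show ?thesis
    using assms by (simp add: continuous_on_eq_continuous_at)
qed

lemma borel_measurable_fBm_cov: "(\<lambda>(u, v). fBm_cov H u v) \<in> borel_measurable borel"
  unfolding fBm_cov_def borel_prod[symmetric] by measurable

text \<open>Both factors are measurable functions of finitely many coordinates of the two
  independent processes, so the expectation of the product factorises.\<close>

lemma (in prob_space) indep_fBm_expectation:
  assumes B1: "fBm M H B1" and B2: "fBm M H B2"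
    and indep: "indep_var (PiM {0..} (\<lambda>_. borel :: real measure)) (\<lambda>\<omega>. \<lambda>t\<in>{0..}. B1 t \<omega>)
                 (PiM {0..} (\<lambda>_. borel :: real measure)) (\<lambda>\<omega>. \<lambda>t\<in>{0..}. B2 t \<omega>)"
    and "u \<ge> 0" "v \<ge> 0" "\<epsilon> > 0"
  shows "has_bochner_integral M
     (\<lambda>\<omega>. (B1 u \<omega> * B1 v \<omega>) * ((B2 (u + \<epsilon>) \<omega> - B2 u \<omega>) * (B2 (v + \<epsilon>) \<omega> - B2 v \<omega>)))
     (fBm_cov H u v * (\<epsilon> powr (2*H) / 2 * powr_diff2 (2*H) ((u - v) / \<epsilon>)))"
proof -
  have c: "(\<lambda>x. x t) \<in> borel_measurable (PiM {0..} (\<lambda>_. borel :: real measure))" if "t \<ge> 0" for t :: real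
    using that by (intro measurable_component_singleton) auto
  have "indep_var borel ((\<lambda>x. x u * x v) \<circ> (\<lambda>\<omega>. \<lambda>t\<in>{0..}. B1 t \<omega>))
      borel ((\<lambda>x. (x (u + \<epsilon>) - x u) * (x (v + \<epsilon>) - x v)) \<circ> (\<lambda>\<omega>. \<lambda>t\<in>{0..}. B2 t \<omega>))"
    using assms(4-) by (intro indep_var_compose[OF indep] borel_measurable_times borel_measurable_diff c) auto
  then have "indep_var borel (\<lambda>\<omega>. B1 u \<omega> * B1 v \<omega>)
      borel (\<lambda>\<omega>. (B2 (u + \<epsilon>) \<omega> - B2 u \<omega>) * (B2 (v + \<epsilon>) \<omega> - B2 v \<omega>))"
    using assms(4-) by (simp add: comp_def)
  from indep_var_lebesgue_integral[OF this] indep_var_integrable[OF this]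
  show ?thesis
    using fBm_has_bochner_integral[OF B1 assms(4,5)] fBm_increments_has_bochner_integral[OF B2 assms(4-6)]
    by (simp add: has_bochner_integral_iff)
qed

text \<open>The powers of \<open>\<epsilon>\<close> in the second moment are \<open>1 - 2*H\<close>
  from the rescaling, \<open>- 2\<close> from the difference quotients and \<open>2*H\<close> from
  the increments. They add up to \<open>- 1\<close>, the scaling at which the covariance kernel
  concentrates on the diagonal with mass 0.\<close>

lemma (in prob_space) fBm_cross_integral_L2:
  fixes B1 B2 :: "real \<Rightarrow> 'a \<Rightarrow> real" and H T :: real
  defines "X \<equiv> (\<lambda>\<epsilon> \<omega>. \<epsilon> powr (1/2 - H) *
          integral {0..T} (\<lambda>u. B1 u \<omega> * ((B2 (u + \<epsilon>) \<omega> - B2 u \<omega>) / \<epsilon>)))"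
  assumes "0 < H" "H < 1/2" and B1: "fBm M H B1" and B2: "fBm M H B2"
    and indep: "indep_var (PiM {0..} (\<lambda>_. borel :: real measure)) (\<lambda>\<omega>. \<lambda>t\<in>{0..}. B1 t \<omega>)
                 (PiM {0..} (\<lambda>_. borel :: real measure)) (\<lambda>\<omega>. \<lambda>t\<in>{0..}. B2 t \<omega>)"
  shows "\<And>\<epsilon>. \<epsilon> > 0 \<Longrightarrow> X \<epsilon> \<in> borel_measurable M"
    and "\<And>\<epsilon>. \<epsilon> > 0 \<Longrightarrow> integrable M (\<lambda>\<omega>. (X \<epsilon> \<omega>)\<^sup>2)"
    and "((\<lambda>\<epsilon>. expectation (\<lambda>\<omega>. (X \<epsilon> \<omega>)\<^sup>2)) \<longlongrightarrow> 0) (at_right 0)"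
proof -
  define L where "L = restrict_space lborel {0..T}"
  interpret L: finite_measure L
    by (rule finite_measureI) (simp add: L_def emeasure_restrict_space emeasure_lborel_Icc_eq)
  have spL: "space L = {0..T}"
    by (simp add: L_def)
  have idL[measurable]: "(\<lambda>u. u) \<in> borel_measurable L"
    unfolding L_def by (intro measurable_restrict_space1) simp
  \<comment> \<open>The truncated times serve joint measurability; on \<open>{0..T}\<close> with
    \<open>\<epsilon> > 0\<close> they change nothing.\<close>
  define g where "g = (\<lambda>\<epsilon> \<omega> u. \<epsilon> powr (1/2 - H) *
      (B1 (max 0 u) \<omega> * ((B2 (max 0 (u + \<epsilon>)) \<omega> - B2 (max 0 u) \<omega>) / \<epsilon>)))"
  have process: "(\<lambda>z. B (max 0 (snd z + \<delta>)) (fst z)) \<in> borel_measurable (M \<Otimes>\<^sub>M L)" if "fBm M H B" for B \<delta>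
  proof -
    have "(\<lambda>z. (fst z, snd z + \<delta>)) \<in> measurable (M \<Otimes>\<^sub>M L) (M \<Otimes>\<^sub>M borel)"
      by measurable
    moreover have "(\<lambda>(\<omega>, u). B (max 0 u) \<omega>) \<in> borel_measurable (M \<Otimes>\<^sub>M borel)"
      using that by (intro borel_measurable_continuous_process) (auto simp: fBm_def)
    ultimately show ?thesis
      by (auto dest: measurable_compose)
  qed
  have g[measurable]: "(\<lambda>(\<omega>, u). g \<epsilon> \<omega> u) \<in> borel_measurable (M \<Otimes>\<^sub>M L)" for \<epsilon>
    using process[OF B1, of 0] process[OF B2, of 0] process[OF B2, of \<epsilon>]
    unfolding g_def case_prod_beta' by simp
  have X_eq: "X \<epsilon> \<omega> = (\<integral>u. g \<epsilon> \<omega> u \<partial>L)" if "\<epsilon> > 0" "\<omega> \<in> space M" for \<epsilon> \<omega>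
  proof -
    have c: "continuous_on {0..} (\<lambda>t. B1 t \<omega>)" "continuous_on {0..} (\<lambda>t. B2 t \<omega>)"
      using B1 B2 that by (auto simp: fBm_def)
    \<comment> \<open>Continuity identifies the gauge integral in \<open>X\<close> with a Lebesgue
      integral, to which Fubini applies.\<close>
    have "continuous_on {0..T} (\<lambda>u. B1 u \<omega> * ((B2 (u + \<epsilon>) \<omega> - B2 u \<omega>) / \<epsilon>))"
      using that
      by (intro continuous_intros continuous_on_compose2[OF c(1)] continuous_on_compose2[OF c(2)]) auto
    from set_borel_integral_eq_integral(2)[OF borel_integrable_atLeastAtMost'[OF this]]
    have "X \<epsilon> \<omega> = \<epsilon> powr (1/2 - H) * (\<integral>u. indicator {0..T} u *
        (B1 u \<omega> * ((B2 (u + \<epsilon>) \<omega> - B2 u \<omega>) / \<epsilon>)) \<partial>lborel)"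
      by (simp only: X_def set_lebesgue_integral_def real_scaleR_def)
    also have "\<dots> = (\<integral>u. \<epsilon> powr (1/2 - H) * (indicator {0..T} u *
        (B1 u \<omega> * ((B2 (u + \<epsilon>) \<omega> - B2 u \<omega>) / \<epsilon>))) \<partial>lborel)"
      by (rule integral_mult_right_zero[symmetric])
    also have "\<dots> = (\<integral>u. indicator {0..T} u * g \<epsilon> \<omega> u \<partial>lborel)"
      by (rule Bochner_Integration.integral_cong) (use that in \<open>auto simp: indicator_def g_def\<close>)
    also have "\<dots> = (\<integral>u. g \<epsilon> \<omega> u \<partial>L)"
      unfolding L_def by (subst integral_restrict_space) auto
    finally show ?thesis .
  qed
  have Eg: "has_bochner_integral M (\<lambda>\<omega>. g \<epsilon> \<omega> u * g \<epsilon> \<omega> v)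
      (fBm_cov H u v * powr_diff2 (2*H) ((u - v) / \<epsilon>) / (2 * \<epsilon>))"
    if "\<epsilon> > 0" "u \<in> {0..T}" "v \<in> {0..T}" for \<epsilon> u v
  proof -
    define k where "k = (\<epsilon> powr (1/2 - H))\<^sup>2 / \<epsilon>\<^sup>2"
    have "has_bochner_integral M (\<lambda>\<omega>. k *
        ((B1 u \<omega> * B1 v \<omega>) * ((B2 (u + \<epsilon>) \<omega> - B2 u \<omega>) * (B2 (v + \<epsilon>) \<omega> - B2 v \<omega>))))
       (k * (fBm_cov H u v * (\<epsilon> powr (2*H) / 2 * powr_diff2 (2*H) ((u - v) / \<epsilon>))))"
      using that by (intro has_bochner_integral_mult_right indep_fBm_expectation[OF B1 B2 indep]) auto
    also have "(\<lambda>\<omega>. k * ((B1 u \<omega> * B1 v \<omega>) * ((B2 (u + \<epsilon>) \<omega> - B2 u \<omega>) * (B2 (v + \<epsilon>) \<omega> - B2 v \<omega>))))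
        = (\<lambda>\<omega>. g \<epsilon> \<omega> u * g \<epsilon> \<omega> v)"
      using that by (simp add: fun_eq_iff g_def k_def power2_eq_square)
    also have "k * (fBm_cov H u v * (\<epsilon> powr (2*H) / 2 * powr_diff2 (2*H) ((u - v) / \<epsilon>)))
        = (k * \<epsilon> powr (2*H)) * (fBm_cov H u v * powr_diff2 (2*H) ((u - v) / \<epsilon>) / 2)"
      by simp
    also have "k * \<epsilon> powr (2*H) = 1 / \<epsilon>"
    proof -
      have "(\<epsilon> powr (1/2 - H))\<^sup>2 * \<epsilon> powr (2*H) = \<epsilon> powr (1/2 - H + (1/2 - H) + 2*H)"
        by (simp only: powr_add power2_eq_square)
      also have "\<dots> = \<epsilon>"
        using \<open>\<epsilon> > 0\<close> by simp
      finally show ?thesis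
        using \<open>\<epsilon> > 0\<close> by (simp add: k_def power2_eq_square)
    qed
    finally show ?thesis by (simp add: mult.commute)
  qed
  have fin: "integrable M (\<lambda>\<omega>. (\<integral>u. g \<epsilon> \<omega> u \<partial>L)\<^sup>2)"
    "expectation (\<lambda>\<omega>. (\<integral>u. g \<epsilon> \<omega> u \<partial>L)\<^sup>2)
      = (\<integral>u. \<integral>v. expectation (\<lambda>\<omega>. g \<epsilon> \<omega> u * g \<epsilon> \<omega> v) \<partial>L \<partial>L)" if "\<epsilon> > 0" for \<epsilon>
  proof -
    have i: "integrable M (\<lambda>\<omega>. (g \<epsilon> \<omega> u)\<^sup>2)" if "u \<in> space L" for u
      using Eg[OF \<open>\<epsilon> > 0\<close>, of u u] that by (auto simp: spL has_bochner_integral_iff power2_eq_square)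
    \<comment> \<open>This is the diagonal case, with lag 0. The bound blows up as
      \<open>\<epsilon>\<close> tends to 0, which is harmless: Fubini is used at each fixed
      \<open>\<epsilon>\<close>.\<close>
    have b: "expectation (\<lambda>\<omega>. (g \<epsilon> \<omega> u)\<^sup>2) \<le> 2 * T powr (2*H) * \<bar>powr_diff2 (2*H) 0\<bar> / (2 * \<epsilon>)"
      if "u \<in> space L" for u
    proof -
      have "expectation (\<lambda>\<omega>. (g \<epsilon> \<omega> u)\<^sup>2) = fBm_cov H u u * powr_diff2 (2*H) 0 / (2 * \<epsilon>)"
        using Eg[OF \<open>\<epsilon> > 0\<close>, of u u] that by (auto simp: spL has_bochner_integral_iff power2_eq_square)
      also have "\<dots> \<le> \<bar>fBm_cov H u u\<bar> * \<bar>powr_diff2 (2*H) 0\<bar> / (2 * \<epsilon>)"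
        using \<open>\<epsilon> > 0\<close> abs_ge_self[of "fBm_cov H u u * powr_diff2 (2*H) 0"]
        by (intro divide_right_mono) (auto simp: abs_mult)
      also have "\<dots> \<le> 2 * T powr (2*H) * \<bar>powr_diff2 (2*H) 0\<bar> / (2 * \<epsilon>)"
        using \<open>\<epsilon> > 0\<close> that spL abs_fBm_cov_le[OF \<open>0 < H\<close>, of u T u]
        by (intro divide_right_mono mult_right_mono) auto
      finally show ?thesis .
    qed
    show "integrable M (\<lambda>\<omega>. (\<integral>u. g \<epsilon> \<omega> u \<partial>L)\<^sup>2)"
      "expectation (\<lambda>\<omega>. (\<integral>u. g \<epsilon> \<omega> u \<partial>L)\<^sup>2)
        = (\<integral>u. \<integral>v. expectation (\<lambda>\<omega>. g \<epsilon> \<omega> u * g \<epsilon> \<omega> v) \<partial>L \<partial>L)"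
      using expectation_square_integral[OF L.finite_measure_axioms g i b] by auto
  qed
  show "X \<epsilon> \<in> borel_measurable M" if "\<epsilon> > 0" for \<epsilon>
  proof -
    have "(\<lambda>\<omega>. \<integral>u. g \<epsilon> \<omega> u \<partial>L) \<in> borel_measurable M"
      by measurable
    then show ?thesis
      using X_eq[OF that] by (simp cong: measurable_cong)
  qed
  show "integrable M (\<lambda>\<omega>. (X \<epsilon> \<omega>)\<^sup>2)" if "\<epsilon> > 0" for \<epsilon>
    using fin(1)[OF that] X_eq[OF that] by (simp cong: Bochner_Integration.integrable_cong)
  have E: "expectation (\<lambda>\<omega>. (X \<epsilon> \<omega>)\<^sup>2)
      = (\<integral>u. \<integral>v. fBm_cov H u v * powr_diff2 (2*H) ((u - v) / \<epsilon>) \<partial>L \<partial>L) / \<epsilon> / 2" if "\<epsilon> > 0" for \<epsilon>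
  proof -
    have "expectation (\<lambda>\<omega>. (X \<epsilon> \<omega>)\<^sup>2) = expectation (\<lambda>\<omega>. (\<integral>u. g \<epsilon> \<omega> u \<partial>L)\<^sup>2)"
      using X_eq[OF that] by (simp cong: Bochner_Integration.integral_cong)
    also have "\<dots> = (\<integral>u. \<integral>v. expectation (\<lambda>\<omega>. g \<epsilon> \<omega> u * g \<epsilon> \<omega> v) \<partial>L \<partial>L)"
      by (rule fin(2)[OF that])
    also have "\<dots> = (\<integral>u. \<integral>v. fBm_cov H u v * powr_diff2 (2*H) ((u - v) / \<epsilon>) / (2 * \<epsilon>) \<partial>L \<partial>L)"
      using Eg[OF that]
      by (intro Bochner_Integration.integral_cong refl) (auto simp: spL has_bochner_integral_iff)
    finally show ?thesis by (simp add: mult.commute)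
  qed
  have "((\<lambda>\<epsilon>. (\<integral>u. \<integral>v. fBm_cov H u v * powr_diff2 (2*H) ((u - v) / \<epsilon>) \<partial>L \<partial>L) / \<epsilon>) \<longlongrightarrow> 0) (at_right 0)"
    unfolding L_def using \<open>0 < H\<close> \<open>H < 1/2\<close>
    by (intro tendsto_scaled_kernel_integral[where C = "2 * T powr (2*H)"] has_bochner_integral_powr_diff2 borel_measurable_fBm_cov
        abs_fBm_cov_le isCont_fBm_cov) auto
  from tendsto_divide[OF this tendsto_const[of 2]]
  have "((\<lambda>\<epsilon>. (\<integral>u. \<integral>v. fBm_cov H u v * powr_diff2 (2*H) ((u - v) / \<epsilon>) \<partial>L \<partial>L) / \<epsilon> / 2) \<longlongrightarrow> 0) (at_right 0)"
    by simp
  then show "((\<lambda>\<epsilon>. expectation (\<lambda>\<omega>. (X \<epsilon> \<omega>)\<^sup>2)) \<longlongrightarrow> 0) (at_right 0)"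
    by (rule Lim_transform_eventually)
       (auto simp: E eventually_at_filter)
qed

theorem theorem6p1:
  fixes M :: "'a measure" and H T :: real
    and B1 B2 :: "real \<Rightarrow> 'a \<Rightarrow> real" and N :: "'a \<Rightarrow> real"
  assumes "prob_space M"
    and "0 < H" and "H < 1/2" and "T > 0"
    and "fBm M H B1" and "fBm M H B2"
    and "prob_space.indep_var M
           (PiM {0..} (\<lambda>_. borel :: real measure)) (\<lambda>\<omega>. \<lambda>t\<in>{0..}. B1 t \<omega>)
           (PiM {0..} (\<lambda>_. borel :: real measure)) (\<lambda>\<omega>. \<lambda>t\<in>{0..}. B2 t \<omega>)"
    and "distributed M lborel N std_normal_density"
    and "indep_rv M borel N
           (PiM {0..} (\<lambda>_. borel :: (real \<times> real) measure)) (\<lambda>\<omega>. \<lambda>t\<in>{0..}. (B1 t \<omega>, B2 t \<omega>))"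
  shows "\<forall>f. bcont_CT T f \<longrightarrow>
    ((\<lambda>\<epsilon>. integral\<^sup>L M (\<lambda>\<omega>. f (\<lambda>t. (B1 t \<omega>, B2 t \<omega>))
        (\<epsilon> powr (1/2 - H) *
          integral {0..T} (\<lambda>u. B1 u \<omega> * ((B2 (u + \<epsilon>) \<omega> - B2 u \<omega>) / \<epsilon>)))))
     \<longlongrightarrow>
     integral\<^sup>L M (\<lambda>\<omega>. f (\<lambda>t. (B1 t \<omega>, B2 t \<omega>))
        (N \<omega> * sqrt ((LBINT x:{0..}. \<bar>x + 1\<bar> powr (2*H) + \<bar>x - 1\<bar> powr (2*H) - 2 * \<bar>x\<bar> powr (2*H))
                     * integral {0..T} (\<lambda>u. (B1 u \<omega>)\<^sup>2)))))
    (at_right 0)"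
proof (intro allI impI)
  fix f assume f: "bcont_CT T f"
  interpret prob_space M by fact
  \<comment> \<open>With this factor zero, the second argument of \<open>f\<close> in the limit is 0
    at every \<open>\<omega>\<close>.\<close>
  have "(LBINT x:{0..}. \<bar>x + 1\<bar> powr (2*H) + \<bar>x - 1\<bar> powr (2*H) - 2 * \<bar>x\<bar> powr (2*H)) = 0"
    using has_bochner_integral_powr_diff2_Ici[of "2*H"] assms(2,3)
    by (simp add: has_bochner_integral_iff set_lebesgue_integral_def powr_diff2_def)
  moreover have "((\<lambda>\<epsilon>. expectation (\<lambda>\<omega>. f (\<lambda>t. (B1 t \<omega>, B2 t \<omega>))
        (\<epsilon> powr (1/2 - H) *
          integral {0..T} (\<lambda>u. B1 u \<omega> * ((B2 (u + \<epsilon>) \<omega> - B2 u \<omega>) / \<epsilon>)))))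
     \<longlongrightarrow> expectation (\<lambda>\<omega>. f (\<lambda>t. (B1 t \<omega>, B2 t \<omega>)) 0)) (at_right 0)"
  proof (rule bcont_CT_tendsto_expectation[OF f \<open>T > 0\<close>])
    show "(\<lambda>\<omega>. (B1 t \<omega>, B2 t \<omega>)) \<in> borel_measurable M" if "t \<in> {0..T}" for t
      using assms(5,6) that by (intro borel_measurable_Pair) (auto simp: fBm_def)
    show "continuous_on {0..T} (\<lambda>t. (B1 t \<omega>, B2 t \<omega>))" if "\<omega> \<in> space M" for \<omega>
    proof -
      have "continuous_on {0..} (\<lambda>t. (B1 t \<omega>, B2 t \<omega>))"
        using assms(5,6) that by (intro continuous_on_Pair) (simp_all add: fBm_def)
      then show ?thesis
        by (rule continuous_on_subset) auto
    qed
  qed (fact fBm_cross_integral_L2[OF assms(2,3,5,6,7)])+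
  ultimately show "((\<lambda>\<epsilon>. integral\<^sup>L M (\<lambda>\<omega>. f (\<lambda>t. (B1 t \<omega>, B2 t \<omega>))
        (\<epsilon> powr (1/2 - H) *
          integral {0..T} (\<lambda>u. B1 u \<omega> * ((B2 (u + \<epsilon>) \<omega> - B2 u \<omega>) / \<epsilon>)))))
     \<longlongrightarrow>
     integral\<^sup>L M (\<lambda>\<omega>. f (\<lambda>t. (B1 t \<omega>, B2 t \<omega>))
        (N \<omega> * sqrt ((LBINT x:{0..}. \<bar>x + 1\<bar> powr (2*H) + \<bar>x - 1\<bar> powr (2*H) - 2 * \<bar>x\<bar> powr (2*H))
                     * integral {0..T} (\<lambda>u. (B1 u \<omega>)\<^sup>2)))))
    (at_right 0)"
    by simp
qed

end
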